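(* Let $\Delta$ be a classifier and let $X_1,\ldots,X_n$ be its protected features. Then $\Delta\wedge\neg(\forall X_1,\ldots,X_n\cdot\Delta)$ characterizes all positive instances on which $\Delta$ will make a biased decision; that is, an instance $\delta$ satisfies this formula if and only if $\Delta(\delta)=1$ and the decision $\Delta(\delta)$ is biased. Moreover, $\neg\Delta\wedge\neg(\forall X_1,\ldots,X_n\cdot\neg\Delta)$ characterizes all negative instances on which $\Delta$ will make a biased decision; that is, an instance $\delta$ satisfies this formula if and only if $\Delta(\delta)=0$ and the decision $\Delta(\delta)$ is biased.
   Context: A classifier is a Boolean formula $\Delta$ over a finite set $\Sigma$ of Boolean variables, called features, some of which are designated as protected. An instance $\delta$ is a set containing exactly one literal for each variable in $\Sigma$ (a truth assignment). The decision is $\Delta(\delta)=1$ (positive instance) if $\delta\models\Delta$ and $\Delta(\delta)=0$ (negative instance) if $\delta\models\neg\Delta$. A decision $\Delta(\delta)$ is biased iff $\Delta(\delta)\neq\Delta(\delta^\star)$ for some instance $\delta^\star$ obtained from $\delta$ by changing only the values of some protected features. Conditioning: $\varphi|x$ (resp. $\varphi|\bar{x}$) is obtained by replacing every occurrence of $X$ in $\varphi$ with true (resp. false). Universal variable quantification is $\forall X\cdot\varphi=(\varphi|x)\wedge(\varphi|\bar{x})$ (up to logical equivalence), and $\forall X_1,\ldots,X_n\cdot\varphi$ denotes successive quantification (in any order). *)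

theory Defs
  imports Main
begin

datatype (vars: 'v) formula =
    FTrue
  | FFalse
  | FVar 'v
  | FNot "'v formula"  ("\<^bold>\<not> _" [75] 75)
  | FAnd "'v formula" "'v formula"  (infixr "\<^bold>\<and>" 70)
  | FOr "'v formula" "'v formula"  (infixr "\<^bold>\<or>" 65)

datatype 'v literal = PosLit 'v | NegLit 'v

definition is_instance :: "'v set \<Rightarrow> 'v literal set \<Rightarrow> bool" where
  "is_instance \<Sigma> \<delta> \<longleftrightarrow>
     \<delta> \<subseteq> PosLit ` \<Sigma> \<union> NegLit ` \<Sigma> \<and>
     (\<forall>X\<in>\<Sigma>. (PosLit X \<in> \<delta>) \<noteq> (NegLit X \<in> \<delta>))"

text \<open>Satisfaction is only meaningful when \<open>\<delta>\<close> is an instance over a set of features that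
  contains all variables of the formula: an absent positive literal counts as false.\<close>

primrec sat :: "'v literal set \<Rightarrow> 'v formula \<Rightarrow> bool"  (infix "\<Turnstile>" 50) where
  "\<delta> \<Turnstile> FTrue \<longleftrightarrow> True"
| "\<delta> \<Turnstile> FFalse \<longleftrightarrow> False"
| "\<delta> \<Turnstile> FVar X \<longleftrightarrow> PosLit X \<in> \<delta>"
| "\<delta> \<Turnstile> \<^bold>\<not> \<phi> \<longleftrightarrow> \<not> \<delta> \<Turnstile> \<phi>"
| "\<delta> \<Turnstile> \<phi> \<^bold>\<and> \<psi> \<longleftrightarrow> \<delta> \<Turnstile> \<phi> \<and> \<delta> \<Turnstile> \<psi>"
| "\<delta> \<Turnstile> \<phi> \<^bold>\<or> \<psi> \<longleftrightarrow> \<delta> \<Turnstile> \<phi> \<or> \<delta> \<Turnstile> \<psi>"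

definition classifier :: "'v set \<Rightarrow> 'v set \<Rightarrow> 'v formula \<Rightarrow> bool" where
  "classifier \<Sigma> P \<Delta> \<longleftrightarrow> finite \<Sigma> \<and> P \<subseteq> \<Sigma> \<and> vars \<Delta> \<subseteq> \<Sigma>"

text \<open>The value is 0 exactly when \<open>\<delta> \<Turnstile> \<^bold>\<not> \<Delta>\<close>.\<close>

definition decision :: "'v formula \<Rightarrow> 'v literal set \<Rightarrow> nat" where
  "decision \<Delta> \<delta> = (if \<delta> \<Turnstile> \<Delta> then 1 else 0)"

definition differs_only_on :: "'v set \<Rightarrow> 'v literal set \<Rightarrow> 'v literal set \<Rightarrow> bool" where
  "differs_only_on P \<delta> \<delta>' \<longleftrightarrow>
     (\<forall>X. X \<notin> P \<longrightarrow> (PosLit X \<in> \<delta> \<longleftrightarrow> PosLit X \<in> \<delta>') \<and> (NegLit X \<in> \<delta> \<longleftrightarrow> NegLit X \<in> \<delta>'))"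

definition biased :: "'v set \<Rightarrow> 'v set \<Rightarrow> 'v formula \<Rightarrow> 'v literal set \<Rightarrow> bool" where
  "biased \<Sigma> P \<Delta> \<delta> \<longleftrightarrow>
     (\<exists>\<delta>'. is_instance \<Sigma> \<delta>' \<and> differs_only_on P \<delta> \<delta>' \<and> decision \<Delta> \<delta> \<noteq> decision \<Delta> \<delta>')"

primrec cond :: "'v \<Rightarrow> 'v formula \<Rightarrow> 'v formula \<Rightarrow> 'v formula" where
  "cond X c FTrue = FTrue"
| "cond X c FFalse = FFalse"
| "cond X c (FVar Y) = (if Y = X then c else FVar Y)"
| "cond X c (\<^bold>\<not> \<phi>) = \<^bold>\<not> cond X c \<phi>"
| "cond X c (\<phi> \<^bold>\<and> \<psi>) = cond X c \<phi> \<^bold>\<and> cond X c \<psi>"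
| "cond X c (\<phi> \<^bold>\<or> \<psi>) = cond X c \<phi> \<^bold>\<or> cond X c \<psi>"

definition forall_var :: "'v \<Rightarrow> 'v formula \<Rightarrow> 'v formula" where
  "forall_var X \<phi> = cond X FTrue \<phi> \<^bold>\<and> cond X FFalse \<phi>"

definition forall_vars :: "'v list \<Rightarrow> 'v formula \<Rightarrow> 'v formula" where
  "forall_vars Xs \<phi> = foldr forall_var Xs \<phi>"

end

theory Submission
  imports Defs
begin

text \<open>Conditioning on a feature amounts to evaluating at the instance whose literal for that feature
  is overwritten. Hence an instance satisfies the quantified formula iff every instance obtained from
  it by changing protected features satisfies the formula, and the negation of this is bias.\<close>

text \<open>Both literals of \<open>X\<close> are removed before one is inserted, so that an
  instance again contains exactly one of them.\<close>

definition assign :: "'v \<Rightarrow> bool \<Rightarrow> 'v literal set \<Rightarrow> 'v literal set" where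
  "assign X b \<delta> = insert (if b then PosLit X else NegLit X) (\<delta> - {PosLit X, NegLit X})"

lemma PosLit_in_assign: "PosLit Y \<in> assign X b \<delta> \<longleftrightarrow> (if Y = X then b else PosLit Y \<in> \<delta>)"
  by (auto simp: assign_def)

lemma NegLit_in_assign: "NegLit Y \<in> assign X b \<delta> \<longleftrightarrow> (if Y = X then \<not> b else NegLit Y \<in> \<delta>)"
  by (auto simp: assign_def)

lemma is_instance_assign:
  assumes "is_instance \<Sigma> \<delta>" and "X \<in> \<Sigma>"
  shows "is_instance \<Sigma> (assign X b \<delta>)"
proof -
  have "assign X b \<delta> \<subseteq> PosLit ` \<Sigma> \<union> NegLit ` \<Sigma>"
    using assms by (auto simp: is_instance_def assign_def)
  then show ?thesis
    using assms by (auto simp: is_instance_def PosLit_in_assign NegLit_in_assign)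
qed

text \<open>Only the variable case of the induction has content: the constant put in place of
  \<open>X\<close> is the truth value that \<open>assign\<close> gives to
  \<open>PosLit X\<close>.\<close>

lemma sat_cond_FTrue: "\<delta> \<Turnstile> cond X FTrue \<phi> \<longleftrightarrow> assign X True \<delta> \<Turnstile> \<phi>"
  by (induction \<phi>) (auto simp: PosLit_in_assign)

lemma sat_cond_FFalse: "\<delta> \<Turnstile> cond X FFalse \<phi> \<longleftrightarrow> assign X False \<delta> \<Turnstile> \<phi>"
  by (induction \<phi>) (auto simp: PosLit_in_assign)

lemma sat_forall_var: "\<delta> \<Turnstile> forall_var X \<phi> \<longleftrightarrow> (\<forall>b. assign X b \<delta> \<Turnstile> \<phi>)"
  by (simp add: forall_var_def sat_cond_FTrue sat_cond_FFalse all_bool_eq)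

lemma differs_only_on_empty_iff: "differs_only_on {} \<delta> \<delta>' \<longleftrightarrow> \<delta> = \<delta>'"
proof
  assume d: "differs_only_on {} \<delta> \<delta>'"
  show "\<delta> = \<delta>'"
  proof (rule set_eqI)
    show "l \<in> \<delta> \<longleftrightarrow> l \<in> \<delta>'" for l
      using d by (cases l) (auto simp: differs_only_on_def)
  qed
qed (simp add: differs_only_on_def)

text \<open>Peels off one protected feature: a change on \<open>insert X A\<close> can be made by
  first fixing the value of \<open>X\<close> and then changing features in \<open>A\<close>.\<close>

lemma differs_only_on_insert_iff:
  assumes "is_instance \<Sigma> \<delta>'" and "X \<in> \<Sigma>"
  shows "differs_only_on (insert X A) \<delta> \<delta>' \<longleftrightarrow> (\<exists>b. differs_only_on A (assign X b \<delta>) \<delta>')"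
proof
  assume "differs_only_on (insert X A) \<delta> \<delta>'"
  \<comment> \<open>The witness is the value of \<open>X\<close> in \<delta>'. As \<delta>' is an
    instance, its negative literal on \<open>X\<close> then agrees as well.\<close>
  then have "differs_only_on A (assign X (PosLit X \<in> \<delta>') \<delta>) \<delta>'"
    using assms by (auto simp: differs_only_on_def is_instance_def PosLit_in_assign NegLit_in_assign)
  then show "\<exists>b. differs_only_on A (assign X b \<delta>) \<delta>'" ..
qed (auto simp: differs_only_on_def PosLit_in_assign NegLit_in_assign)

lemma sat_forall_vars:
  assumes "is_instance \<Sigma> \<delta>" and "set Xs \<subseteq> \<Sigma>"
  shows "\<delta> \<Turnstile> forall_vars Xs \<phi> \<longleftrightarrow>
    (\<forall>\<delta>'. is_instance \<Sigma> \<delta>' \<and> differs_only_on (set Xs) \<delta> \<delta>' \<longrightarrow> \<delta>' \<Turnstile> \<phi>)"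
  using assms
\<comment> \<open>\<delta> is generalized because the induction hypothesis is applied to
  \<open>assign X b \<delta>\<close>, for both values of \<open>b\<close>.\<close>
proof (induction Xs arbitrary: \<delta>)
  case Nil
  then show ?case by (auto simp: forall_vars_def differs_only_on_empty_iff)
next
  case (Cons X Xs)
  have "\<delta> \<Turnstile> forall_vars (X # Xs) \<phi> \<longleftrightarrow> (\<forall>b. assign X b \<delta> \<Turnstile> forall_vars Xs \<phi>)"
    by (simp add: forall_vars_def sat_forall_var)
  also have "\<dots> \<longleftrightarrow> (\<forall>b \<delta>'. is_instance \<Sigma> \<delta>' \<and> differs_only_on (set Xs) (assign X b \<delta>) \<delta>' \<longrightarrow> \<delta>' \<Turnstile> \<phi>)"
    using Cons by (simp add: is_instance_assign)
  \<comment> \<open>The universal \<open>b\<close> becomes an existential inside the premise, where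
    the peeling lemma absorbs it.\<close>
  also have "\<dots> \<longleftrightarrow> (\<forall>\<delta>'. is_instance \<Sigma> \<delta>' \<and> differs_only_on (set (X # Xs)) \<delta> \<delta>' \<longrightarrow> \<delta>' \<Turnstile> \<phi>)"
    using Cons.prems differs_only_on_insert_iff[of \<Sigma> _ X "set Xs" \<delta>] by auto
  finally show ?case .
qed

theorem theorem11:
  fixes \<Sigma> :: "'v set" and \<Delta> :: "'v formula" and Xs :: "'v list"
  assumes "classifier \<Sigma> (set Xs) \<Delta>"
    and "distinct Xs"
  shows "(\<forall>\<delta>. is_instance \<Sigma> \<delta> \<longrightarrow>
            (\<delta> \<Turnstile> \<Delta> \<^bold>\<and> \<^bold>\<not> (forall_vars Xs \<Delta>) \<longleftrightarrow>
              decision \<Delta> \<delta> = 1 \<and> biased \<Sigma> (set Xs) \<Delta> \<delta>)) \<and>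
         (\<forall>\<delta>. is_instance \<Sigma> \<delta> \<longrightarrow>
            (\<delta> \<Turnstile> \<^bold>\<not> \<Delta> \<^bold>\<and> \<^bold>\<not> (forall_vars Xs (\<^bold>\<not> \<Delta>)) \<longleftrightarrow>
              decision \<Delta> \<delta> = 0 \<and> biased \<Sigma> (set Xs) \<Delta> \<delta>))"
proof -
  have "set Xs \<subseteq> \<Sigma>"
    using assms by (simp add: classifier_def)
  \<comment> \<open>Once the decision on \<delta> is fixed, a variant with a different decision is
    exactly one falsifying \<Delta> (for decision 1) or its negation (for decision 0), hence a
    counterexample to the quantified formula.\<close>
  then show ?thesis
    by (auto simp: sat_forall_vars biased_def decision_def split: if_splits)
qed

end
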